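(* Let $\nu$ be a real number and let $h_\nu:\mathbb{D}\to\mathbb{C}$ be the normalized Struve function $$h_{\nu}(z)=\sqrt{\pi}\,2^{\nu}\,\Gamma\left(\nu+\tfrac{3}{2}\right)z^{\frac{1-\nu}{2}}\mathbf{H}_{\nu}(\sqrt{z})=\frac{\sqrt{\pi}}{2}\sum_{n\geq0}\frac{(-1)^n\,\Gamma\left(\nu+\frac{3}{2}\right)z^{n+1}}{4^n\,\Gamma\left(n+\frac{3}{2}\right)\Gamma\left(\nu+n+\frac{3}{2}\right)}.$$ If $|\nu|\leq \frac{1}{2}$, then $h_{\nu}$ is starlike in $\mathbb{D}$ and all of its derivatives are close-to-convex in $\mathbb{D}$.
   Context: $\mathbb{D}=\{z\in\mathbb{C}:|z|<1\}$ is the open unit disk. $\mathbf{H}_\nu$ is the Struve function of the first kind, $\mathbf{H}_\nu(z)=\sum_{n\ge0}\frac{(-1)^n}{\Gamma(n+\frac32)\Gamma(\nu+n+\frac32)}\left(\frac z2\right)^{2n+\nu+1}$. "All of its derivatives" means $h_\nu^{(k)}$ for all integers $k\ge1$. The terms are used in the usual sense of geometric function theory, without requiring the derivatives to be normalized: a function analytic in $\mathbb{D}$ and vanishing at $0$ is starlike if it is univalent and its image is starlike with respect to $0$; an analytic function $g$ is close-to-convex in $\mathbb{D}$ if there is a function $\phi$ that is univalent on $\mathbb{D}$ with convex image and satisfies $\mathrm{Re}\,(g'(z)/\phi'(z))>0$ for all $z\in\mathbb{D}$. *)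

theory Defs
  imports "HOL-Complex_Analysis.Complex_Analysis"
begin

(* The library's Gamma is 0 at its poles and 1 / 0 = 0, so the coefficients are the values of the
   entire function 1 / Gamma for every real nu. *)
definition struve_H :: "real \<Rightarrow> complex \<Rightarrow> complex" where
  "struve_H \<nu> z =
     (\<Sum>n. (- 1) ^ n / (Gamma (of_nat n + 3 / 2) * Gamma (of_real \<nu> + of_nat n + 3 / 2))
           * (z / 2) powr (2 * of_nat n + of_real \<nu> + 1))"

(* Principal branches of the power and of the square root. *)
definition struve_h :: "real \<Rightarrow> complex \<Rightarrow> complex" where
  "struve_h \<nu> z =
     of_real (sqrt pi) * 2 powr of_real \<nu> * Gamma (of_real \<nu> + 3 / 2)
       * z powr ((1 - of_real \<nu>) / 2) * struve_H \<nu> (csqrt z)"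

lemma struve_h_series_summable:
  fixes v z :: complex
  shows "summable (\<lambda>n. (- 1) ^ n * Gamma (v + 3 / 2) * z ^ (n + 1)
           / (4 ^ n * Gamma (of_nat n + 3 / 2) * Gamma (v + of_nat n + 3 / 2)))"
proof -
  define f where "f = (\<lambda>n. (- 1) ^ n * Gamma (v + 3 / 2) * z ^ (n + 1) / 4 ^ n
           * rGamma (of_nat n + 3 / 2) * rGamma (v + of_nat n + 3 / 2))"
  obtain N :: nat where N: "norm z + norm v \<le> of_nat N"
    using real_arch_simple by blast
  have "summable f"
  proof (rule summable_ratio_test[where c = "1 / 2" and N = N])
    fix n assume "n \<ge> N"
    hence n: "norm z + norm v \<le> of_nat n" using N by linarith
    define a b where "a = (of_nat n + 3 / 2 :: complex)" and "b = v + of_nat n + 3 / 2"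
    have a: "rGamma a = a * rGamma (a + 1)" and b: "rGamma b = b * rGamma (b + 1)"
      by (simp_all add: rGamma_plus1)
    have "norm a \<ge> norm (of_nat n :: complex)"
      unfolding a_def using complex_Re_le_cmod[of "of_nat n + 3 / 2"] by simp
    hence na: "norm z \<le> norm a" using n norm_ge_zero[of v] by (smt (verit) norm_of_nat)
    have "norm b \<ge> norm (of_nat n + 3 / 2 :: complex) - norm v"
      unfolding b_def using norm_diff_ineq[of "of_nat n + 3 / 2 :: complex" v]
      by (simp add: add_ac)
    moreover have "norm (of_nat n + 3 / 2 :: complex) \<ge> of_nat n + 3 / 2"
      using complex_Re_le_cmod[of "of_nat n + 3 / 2"] by simp
    ultimately have nb: "1 \<le> norm b" using n norm_ge_zero[of z] by linarith
    define r where "r = (- 1) ^ n * Gamma (v + 3 / 2) * z ^ (n + 1) / 4 ^ n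
           * rGamma (a + 1) * rGamma (b + 1)"
    have fn: "f n = r * (a * b)"
      unfolding f_def r_def a_def[symmetric] b_def[symmetric] a b by simp
    have fS: "f (Suc n) = r * (- z / 4)"
      unfolding f_def r_def a_def b_def by (simp add: add_ac mult_ac)
    have "norm z * 1 \<le> norm a * norm b"
      by (intro mult_mono na nb) auto
    moreover have "0 \<le> norm a * norm b" by simp
    moreover have "norm (- z / 4) = norm z / 4" by (simp add: norm_divide)
    ultimately have "norm (- z / 4) \<le> 1 / 2 * norm (a * b)"
      unfolding norm_mult by linarith
    hence "norm r * norm (- z / 4) \<le> norm r * (1 / 2 * norm (a * b))"
      by (rule mult_left_mono) simp
    thus "norm (f (Suc n)) \<le> 1 / 2 * norm (f n)"
      unfolding fn fS norm_mult[of r] by (simp only: mult_ac)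
  qed simp
  moreover have "f = (\<lambda>n. (- 1) ^ n * Gamma (v + 3 / 2) * z ^ (n + 1)
           / (4 ^ n * Gamma (of_nat n + 3 / 2) * Gamma (v + of_nat n + 3 / 2)))"
    unfolding f_def by (simp add: rGamma_inverse_Gamma field_simps fun_eq_iff)
  ultimately show ?thesis by simp
qed

(* The branches cancel: struve_h is the power series below, also on the cut and at 0. *)
lemma struve_h_series:
  "struve_h \<nu> z = of_real (sqrt pi) / 2 *
     (\<Sum>n. (- 1) ^ n * Gamma (of_real \<nu> + 3 / 2) * z ^ (n + 1)
           / (4 ^ n * Gamma (of_nat n + 3 / 2) * Gamma (of_real \<nu> + of_nat n + 3 / 2)))"
proof (cases "z = 0")
  case True
  then show ?thesis by (simp add: struve_h_def)
next
  case False
  define v :: complex where "v = of_real \<nu>"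
  define K where "K = of_real (sqrt pi) * 2 powr v * Gamma (v + 3 / 2) * z powr ((1 - v) / 2)"
  have half: "(csqrt z / 2) powr s = exp (s * (Ln z / 2 - Ln 2))" for s :: complex
  proof -
    have "csqrt z = exp (Ln z / 2)" using False by (rule csqrt_exp_Ln)
    hence "csqrt z / 2 = exp (Ln z / 2 - Ln 2)" by (simp add: exp_diff)
    moreover have "Ln (exp (Ln z / 2 - Ln 2)) = Ln z / 2 - Ln 2"
    proof (rule Ln_exp)
      have "Im (Ln (2::complex)) = 0" using Ln_of_real[of 2] by simp
      then show "- pi < Im (Ln z / 2 - Ln 2)" "Im (Ln z / 2 - Ln 2) \<le> pi"
        using mpi_less_Im_Ln[OF False] Im_Ln_le_pi[OF False] pi_gt_zero by auto
    qed
    ultimately show ?thesis by (simp add: powr_def)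
  qed
  have pw: "2 powr v * z powr ((1 - v) / 2) * (csqrt z / 2) powr (2 * of_nat n + v + 1)
      = z ^ (n + 1) / (2 * 4 ^ n)" for n
  proof -
    have "2 powr v * z powr ((1 - v) / 2) * (csqrt z / 2) powr (2 * of_nat n + v + 1)
       = exp (v * Ln 2 + (1 - v) / 2 * Ln z + (2 * of_nat n + v + 1) * (Ln z / 2 - Ln 2))"
      unfolding half using False by (simp add: powr_def exp_add)
    also have "v * Ln 2 + (1 - v) / 2 * Ln z + (2 * of_nat n + v + 1) * (Ln z / 2 - Ln 2)
       = of_nat (n + 1) * Ln z - of_nat (2 * n + 1) * Ln 2"
      by (simp add: field_simps)
    also have "exp \<dots> = z ^ (n + 1) / 2 ^ (2 * n + 1)"
      using False by (simp only: exp_diff exp_of_nat_mult) simp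
    also have "(2::complex) ^ (2 * n + 1) = 2 * 4 ^ n"
      by (simp add: power_mult)
    finally show ?thesis .
  qed
  let ?c = "\<lambda>n. (- 1) ^ n / (Gamma (of_nat n + 3 / 2) * Gamma (v + of_nat n + 3 / 2)) :: complex"
  let ?d = "\<lambda>n. (- 1) ^ n * Gamma (v + 3 / 2) * z ^ (n + 1)
           / (4 ^ n * Gamma (of_nat n + 3 / 2) * Gamma (v + of_nat n + 3 / 2))"
  have K: "K \<noteq> 0 \<or> Gamma (v + 3 / 2) = 0" using False by (simp add: K_def)
  have eq: "K * (?c n * (csqrt z / 2) powr (2 * of_nat n + v + 1)) = of_real (sqrt pi) / 2 * ?d n" for n
  proof -
    have "K * (?c n * (csqrt z / 2) powr (2 * of_nat n + v + 1))
       = of_real (sqrt pi) * Gamma (v + 3 / 2) * ?c n *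
         (2 powr v * z powr ((1 - v) / 2) * (csqrt z / 2) powr (2 * of_nat n + v + 1))"
      by (simp add: K_def)
    also have "\<dots> = of_real (sqrt pi) / 2 * ?d n" unfolding pw by (simp add: mult_ac)
    finally show ?thesis .
  qed
  have "K * (\<Sum>n. ?c n * (csqrt z / 2) powr (2 * of_nat n + v + 1)) =
        of_real (sqrt pi) / 2 * (\<Sum>n. ?d n)"
  proof (cases "K = 0")
    case True
    with K have "Gamma (v + 3 / 2) = 0" by auto
    with True show ?thesis by simp
  next
    case False
    let ?t = "\<lambda>n. ?c n * (csqrt z / 2) powr (2 * of_nat n + v + 1)"
    have t: "?t n = (of_real (sqrt pi) / 2 / K) * ?d n" for n
    proof -
      have "K * x = c * y \<Longrightarrow> x = (c / K) * y" for x y c :: complex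
        using False by (simp add: eq_divide_eq mult.commute)
      from this[OF eq] show ?thesis .
    qed
    have d: "summable ?d" by (rule struve_h_series_summable)
    have "(\<Sum>n. ?t n) = (of_real (sqrt pi) / 2 / K) * (\<Sum>n. ?d n)"
      unfolding t using d by (rule suminf_mult)
    then show ?thesis using False by simp
  qed
  then show ?thesis unfolding struve_h_def struve_H_def K_def v_def by simp
qed

definition univalent_on :: "(complex \<Rightarrow> complex) \<Rightarrow> complex set \<Rightarrow> bool" where
  "univalent_on f S \<longleftrightarrow> f holomorphic_on S \<and> inj_on f S"

definition starlike_fun :: "(complex \<Rightarrow> complex) \<Rightarrow> bool" where
  "starlike_fun f \<longleftrightarrow>
     f 0 = 0 \<and> univalent_on f (ball 0 1) \<and>
     (\<forall>w \<in> f ` ball 0 1. closed_segment 0 w \<subseteq> f ` ball 0 1)"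

definition close_to_convex :: "(complex \<Rightarrow> complex) \<Rightarrow> bool" where
  "close_to_convex g \<longleftrightarrow>
     g holomorphic_on ball 0 1 \<and>
     (\<exists>\<phi>. univalent_on \<phi> (ball 0 1) \<and> convex (\<phi> ` ball 0 1) \<and>
          (\<forall>z \<in> ball 0 1. Re (deriv g z / deriv \<phi> z) > 0))"

end

theory Submission
  imports Defs
begin

text \<open>
  For \<open>\<bar>\<nu>\<bar> \<le> 1 / 2\<close> the power series of \<open>h = struve_h \<nu>\<close> is dominated by its first terms, so both
  claims follow from crude size estimates. The Gamma quotients in the coefficients give, for
  \<open>n \<ge> 0\<close>, the two-term recurrence
  \<open>4 (n + 3/2) (\<nu> + n + 3/2) h\<^sup>(\<^sup>n\<^sup>+\<^sup>2\<^sup>)(0) = - (n + 2) h\<^sup>(\<^sup>n\<^sup>+\<^sup>1\<^sup>)(0)\<close>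
  (\<open>higher_deriv_struve_h_0_Suc\<close>). As \<open>\<nu> + 3/2 \<ge> 1\<close>, each derivative of order at least
  3 has at \<open>0\<close> at most \<open>3/20\<close> times the modulus of the derivative one order below. Comparison of
  the Taylor series with a geometric series
  (\<open>higher_deriv_near_value_at_0\<close>) then shows that on the disk every derivative of order at least
  2 differs from its value at \<open>0\<close> by at most \<open>3/17\<close> of the modulus of that value.

  Close-to-convexity of a derivative of order \<open>k \<ge> 1\<close> follows at once, with a linear function as
  the convex function \<open>\<phi>\<close>: the next derivative stays in a disk around \<open>h\<^sup>(\<^sup>k\<^sup>+\<^sup>1\<^sup>)(0)\<close> that does not
  reach \<open>0\<close>, so its quotient by that number has positive real part.

  For starlikeness, \<open>\<bar>h''(0)\<bar> \<le> 1/3\<close> gives \<open>\<bar>h''\<bar> \<le> (1/3) (20/17) < 1/2\<close> on the disk.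
  A function with \<open>f(0) = 0\<close>, \<open>f'(0) = 1\<close> and \<open>\<bar>f''\<bar> \<le> 1/2\<close> is so close to the identity that the
  equation \<open>f(u) = t f(z)\<close> can be solved near \<open>t z\<close> by the contraction principle
  (\<open>starlike_fun_if_second_deriv_le_half\<close>), which puts the segment from \<open>0\<close> to \<open>f(z)\<close> into the
  image.
\<close>

section \<open>Geometric criteria for functions close to a linear one\<close>

text \<open>
  Write \<open>f(z) = z + g(z)\<close>. Since \<open>f'\<close> is \<open>1/2\<close>-Lipschitz and \<open>f'(0) = 1\<close>, also \<open>g\<close> is
  \<open>1/2\<close>-Lipschitz, and \<open>f\<close> is injective. For \<open>0 \<le> t \<le> 1\<close>, a solution of \<open>f(u) = t f(z)\<close> is a fixed
  point of the contraction \<open>T(u) = t f(z) - g(u)\<close>. The ball of radius \<open>(1 - t) \<bar>z\<bar>\<close> around \<open>t z\<close> lies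
  in the disk, and \<open>T\<close> maps it to itself: in
  \<open>T(u) - t z = (g(t z) - g(u)) + (t g(z) - g(t z))\<close> each bracket is at most half the radius.
\<close>

lemma starlike_fun_if_second_deriv_le_half:
  assumes hol: "f holomorphic_on ball 0 1"
    and f0: "f 0 = 0" and f1: "deriv f 0 = 1"
    and f2: "\<And>z. z \<in> ball 0 1 \<Longrightarrow> norm (deriv (deriv f) z) \<le> 1 / 2"
  shows "starlike_fun f"
proof -
  let ?D = "ball 0 1 :: complex set"
  define g where "g z = f z - z" for z
  have df: "(f has_field_derivative deriv f z) (at z)" if "z \<in> ?D" for z
    using hol that by (intro holomorphic_derivI[where S = ?D]) auto
  have ddf: "(deriv f has_field_derivative deriv (deriv f) z) (at z)" if "z \<in> ?D" for z
    using hol that by (intro holomorphic_derivI[where S = ?D] holomorphic_deriv) auto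
  have deriv_lip: "norm (deriv f z - deriv f w) \<le> 1 / 2 * norm (z - w)"
    if "z \<in> ?D" "w \<in> ?D" for z w
    using that ddf f2
    by (intro field_differentiable_bound[where S = ?D]) (auto intro: DERIV_subset)
  have dg: "(g has_field_derivative deriv f z - 1) (at z)" if "z \<in> ?D" for z
    unfolding g_def using df[OF that] by (auto intro!: derivative_eq_intros)
  have g_lip: "norm (g z - g w) \<le> 1 / 2 * norm (z - w)" if "z \<in> ?D" "w \<in> ?D" for z w
  proof (rule field_differentiable_bound[where S = ?D])
    fix u assume u: "u \<in> ?D"
    show "(g has_field_derivative deriv f u - 1) (at u within ?D)"
      using dg[OF u] by (rule DERIV_subset) auto
    show "norm (deriv f u - 1) \<le> 1 / 2"
      using deriv_lip[OF u, of 0] u by (simp add: f1)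
  qed (use that in auto)
  have inj: "inj_on f ?D"
  proof (rule inj_onI)
    fix x y assume xy: "x \<in> ?D" "y \<in> ?D" "f x = f y"
    have "norm (x - y) \<le> 1 / 2 * norm (x - y)"
      using g_lip[OF xy(1,2)] xy(3) by (simp add: g_def norm_minus_commute)
    then show "x = y" by simp
  qed
  have segment: "of_real t * f z \<in> f ` ?D" if z: "z \<in> ?D" and t: "0 \<le> t" "t \<le> 1" for z t
  proof -
    let ?K = "cball (of_real t * z) ((1 - t) * norm z)"
    define T where "T u = of_real t * f z - g u" for u
    have scaled: "of_real t * u \<in> ?D" if "u \<in> ?D" for u
      using that t mult_le_one[of t "norm u"] mult_left_le_one_le[of "norm u" t]
      by (auto simp: norm_mult)
    have K: "?K \<subseteq> ?D"
    proof
      fix u assume "u \<in> ?K"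
      then have "norm (u - of_real t * z) \<le> (1 - t) * norm z"
        by (simp add: dist_norm norm_minus_commute)
      moreover have "norm u \<le> norm (u - of_real t * z) + norm (of_real t * z)"
        using norm_triangle_ineq[of "u - of_real t * z" "of_real t * z"] by simp
      ultimately have "norm u \<le> norm z"
        using t by (simp add: norm_mult algebra_simps)
      then show "u \<in> ?D" using z by simp
    qed
    \<comment> \<open>The failure of \<open>g\<close> to commute with the scaling by \<open>t\<close>: its derivative in \<open>u\<close> is
      \<open>t (f' (t u) - f' u)\<close>, which is of size \<open>1 - t\<close>.\<close>
    have "norm ((g (of_real t * z) - of_real t * g z) - (g (of_real t * 0) - of_real t * g 0))
        \<le> (1 - t) / 2 * norm (z - 0)"
    proof (rule field_differentiable_bound[where S = ?D])
      fix u assume u: "u \<in> ?D"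
      have "((\<lambda>u. g (of_real t * u)) has_field_derivative (deriv f (of_real t * u) - 1) * of_real t)
          (at u)"
        by (rule DERIV_chain2[where f = g and g = "(*) (of_real t)"])
          (use dg[OF scaled[OF u]] in \<open>auto intro!: derivative_eq_intros\<close>)
      moreover have "((\<lambda>u. of_real t * g u) has_field_derivative of_real t * (deriv f u - 1)) (at u)"
        by (rule DERIV_cmult[OF dg[OF u]])
      ultimately have "((\<lambda>u. g (of_real t * u) - of_real t * g u) has_field_derivative
          of_real t * (deriv f (of_real t * u) - deriv f u)) (at u)"
        by (rule DERIV_cong[OF DERIV_diff]) (simp add: algebra_simps)
      then show "((\<lambda>u. g (of_real t * u) - of_real t * g u) has_field_derivative
          of_real t * (deriv f (of_real t * u) - deriv f u)) (at u within ?D)"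
        by (rule DERIV_subset) auto
      have "of_real t * u - u = - (of_real (1 - t) * u)"
        by (simp add: algebra_simps)
      then have "norm (of_real t * u - u) = (1 - t) * norm u"
        using t by (simp only: norm_minus_cancel norm_mult norm_of_real)
      then have "norm (deriv f (of_real t * u) - deriv f u) \<le> (1 - t) / 2 * norm u"
        using deriv_lip[OF scaled[OF u] u] by simp
      also have "\<dots> \<le> (1 - t) / 2 * 1"
        using u t by (intro mult_left_mono) auto
      finally have "t * norm (deriv f (of_real t * u) - deriv f u) \<le> 1 * ((1 - t) / 2 * 1)"
        using t by (intro mult_mono) auto
      then show "norm (of_real t * (deriv f (of_real t * u) - deriv f u)) \<le> (1 - t) / 2"
        using t by (simp add: norm_mult)
    qed (use z in auto)
    then have defect: "norm (g (of_real t * z) - of_real t * g z) \<le> (1 - t) / 2 * norm z"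
      by (simp add: g_def f0)
    have "\<exists>!u\<in>?K. T u = u"
    proof (rule Banach_fix[where c = "1 / 2"])
      show "complete ?K" by (simp add: complete_eq_closed)
      show "?K \<noteq> {}" using t mult_nonneg_nonneg[of "1 - t" "norm z"] by (simp add: not_less)
      show "T ` ?K \<subseteq> ?K"
      proof safe
        fix u assume u: "u \<in> ?K"
        have "T u - of_real t * z
            = - (g u - g (of_real t * z)) - (g (of_real t * z) - of_real t * g z)"
          by (simp add: T_def g_def algebra_simps)
        then have "norm (T u - of_real t * z)
            \<le> norm (g u - g (of_real t * z)) + norm (g (of_real t * z) - of_real t * g z)"
          by (metis norm_minus_cancel norm_triangle_ineq4)
        moreover have "norm (g u - g (of_real t * z)) \<le> 1 / 2 * norm (u - of_real t * z)"
          using u K scaled[OF z] by (intro g_lip) auto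
        moreover have "norm (u - of_real t * z) \<le> (1 - t) * norm z"
          using u by (simp add: dist_norm norm_minus_commute)
        ultimately have "norm (T u - of_real t * z) \<le> (1 - t) * norm z"
          using defect by linarith
        then show "T u \<in> ?K" by (simp add: dist_norm norm_minus_commute)
      qed
      fix x y assume "x \<in> ?K" "y \<in> ?K"
      then have "norm (g x - g y) \<le> 1 / 2 * norm (x - y)"
        using K by (intro g_lip) auto
      then show "dist (T x) (T y) \<le> 1 / 2 * dist x y"
        by (simp add: T_def dist_norm norm_minus_commute)
    qed auto
    then obtain u where "u \<in> ?K" "T u = u" by blast
    then have "u \<in> ?D" "f u = of_real t * f z"
      using K by (auto simp: T_def g_def)
    then show ?thesis by (metis imageI)
  qed
  show ?thesis
    unfolding starlike_fun_def univalent_on_def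
  proof (intro conjI ballI subsetI)
    fix w x assume w: "w \<in> f ` ?D" and "x \<in> closed_segment 0 w"
    then obtain t where "0 \<le> t" "t \<le> 1" "x = of_real t * w"
      by (auto simp: in_segment scaleR_conv_of_real)
    then show "x \<in> f ` ?D" using w segment by blast
  qed (use hol f0 inj in auto)
qed

text \<open>
  The linear function \<open>\<phi>(z) = c z\<close> serves as the convex comparison function: the hypothesis says
  \<open>\<bar>g' / c - 1\<bar> < 1\<close>, and the disk of radius 1 around 1 lies in the right half-plane.
\<close>

lemma close_to_convex_if_deriv_near_const:
  assumes hol: "g holomorphic_on ball 0 1"
    and near: "\<And>z. z \<in> ball 0 1 \<Longrightarrow> norm (deriv g z - c) < norm c"
  shows "close_to_convex g"
proof -
  have c: "c \<noteq> 0" using near[of 0] by auto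
  have "univalent_on ((*) c) (ball 0 1)"
    using c by (auto simp: univalent_on_def inj_on_def intro!: holomorphic_intros)
  moreover have "convex ((*) c ` ball 0 1)"
    by (intro convex_linear_image) (auto intro: linear_times)
  moreover have "Re (deriv g z / deriv ((*) c) z) > 0" if z: "z \<in> ball 0 1" for z
  proof -
    have "deriv ((*) c) z = c"
      by (intro DERIV_imp_deriv) (auto intro!: derivative_eq_intros)
    moreover have "norm (deriv g z / c - 1) < 1"
      using near[OF z] c by (simp add: diff_divide_distrib[symmetric] norm_divide
          divide_simps flip: diff_divide_eq_iff)
    then have "\<bar>Re (deriv g z / c - 1)\<bar> < 1"
      using abs_Re_le_cmod le_less_trans by blast
    ultimately show ?thesis by simp
  qed
  ultimately show ?thesis using hol unfolding close_to_convex_def by blast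
qed

section \<open>Derivatives of geometrically decreasing size at the origin\<close>

text \<open>
  The Taylor coefficients of the \<open>k\<close>-th derivative are at most \<open>\<rho>\<^sup>n\<close> times the constant one (even
  after the factor \<open>1 / n!\<close> is dropped), so its series without the constant term is dominated by
  \<open>\<rho> + \<rho>\<^sup>2 + \<dots> = \<rho> / (1 - \<rho>)\<close>.
\<close>

lemma higher_deriv_near_value_at_0:
  assumes hol: "f holomorphic_on ball 0 1"
    and ratio: "\<And>n. n \<ge> k \<Longrightarrow>
      norm ((deriv ^^ Suc n) f 0) \<le> \<rho> * norm ((deriv ^^ n) f 0)"
    and \<rho>: "0 \<le> \<rho>" "\<rho> < 1" and z: "z \<in> ball 0 1"
  shows "norm ((deriv ^^ k) f z - (deriv ^^ k) f 0) \<le> \<rho> / (1 - \<rho>) * norm ((deriv ^^ k) f 0)"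
proof -
  define b where "b n = (deriv ^^ (n + k)) f 0" for n
  have b_le: "norm (b n) \<le> norm (b 0) * \<rho> ^ n" for n
  proof (induction n)
    case (Suc n)
    have "norm (b (Suc n)) \<le> \<rho> * norm (b n)"
      using ratio[of "n + k"] by (simp add: b_def)
    also have "\<dots> \<le> \<rho> * (norm (b 0) * \<rho> ^ n)"
      using Suc \<rho> by (intro mult_left_mono) auto
    finally show ?case by (simp add: mult_ac)
  qed simp
  have "(deriv ^^ k) f holomorphic_on ball 0 1"
    using hol by (intro holomorphic_higher_deriv) auto
  from holomorphic_power_series[OF this z]
  have "(\<lambda>n. b n / fact n * z ^ n) sums (deriv ^^ k) f z"
    by (simp add: b_def funpow_add)
  then have "(\<lambda>n. b (Suc n) / fact (Suc n) * z ^ Suc n) sums ((deriv ^^ k) f z - b 0)"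
    by (subst sums_Suc_iff) simp
  moreover have "(\<lambda>n. norm (b 0) * \<rho> * \<rho> ^ n) sums (norm (b 0) * \<rho> * (1 / (1 - \<rho>)))"
    using \<rho> by (intro sums_mult geometric_sums) auto
  moreover have "norm (b (Suc n) / fact (Suc n) * z ^ Suc n) \<le> norm (b 0) * \<rho> * \<rho> ^ n" for n
  proof -
    have "norm (b (Suc n) / fact (Suc n) * z ^ Suc n)
        = norm (b (Suc n)) * (norm z ^ Suc n / fact (Suc n))"
      by (simp only: norm_mult norm_divide norm_power norm_fact) simp
    also have "\<dots> \<le> norm (b (Suc n)) * 1"
    proof (rule mult_left_mono)
      have "norm z ^ Suc n \<le> 1" using z by (intro power_le_one) auto
      also have "(1::real) \<le> fact (Suc n)" by (rule fact_ge_1)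
      finally show "norm z ^ Suc n / fact (Suc n) \<le> 1" by simp
    qed simp
    finally show ?thesis using b_le[of "Suc n"] by (simp add: mult_ac)
  qed
  ultimately have "norm ((deriv ^^ k) f z - b 0) \<le> norm (b 0) * \<rho> * (1 / (1 - \<rho>))"
    by (metis (no_types, lifting) norm_suminf_le sums_summable sums_unique)
  then show ?thesis by (simp add: b_def mult_ac)
qed

section \<open>The derivatives of the Struve function at the origin\<close>

lemma
  fixes \<nu> :: real
  defines "a \<equiv> \<lambda>n. of_real (sqrt pi) / 2 * ((- 1) ^ n * Gamma (of_real \<nu> + 3 / 2)
           / (4 ^ n * Gamma (of_nat n + 3 / 2) * Gamma (of_real \<nu> + of_nat n + 3 / 2))) :: complex"
  shows holomorphic_struve_h: "struve_h \<nu> holomorphic_on UNIV"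
    and higher_deriv_struve_h_0: "(deriv ^^ Suc n) (struve_h \<nu>) 0 = fact (Suc n) * a n"
proof -
  define F where "F = Abs_fps (\<lambda>n. if n = 0 then 0 else a (n - 1))"
  have sums: "(\<lambda>n. fps_nth F n * z ^ n) sums struve_h \<nu> z" for z
  proof -
    have "(\<lambda>n. of_real (sqrt pi) / 2 * ((- 1) ^ n * Gamma (of_real \<nu> + 3 / 2) * z ^ (n + 1)
           / (4 ^ n * Gamma (of_nat n + 3 / 2) * Gamma (of_real \<nu> + of_nat n + 3 / 2))))
        sums struve_h \<nu> z"
      unfolding struve_h_series by (intro sums_mult summable_sums struve_h_series_summable)
    then have "(\<lambda>n. fps_nth F (Suc n) * z ^ Suc n) sums struve_h \<nu> z"
      by (simp add: F_def a_def mult_ac)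
    then show ?thesis by (subst (asm) sums_Suc_iff) (simp add: F_def)
  qed
  have radius: "fps_conv_radius F = \<infinity>"
    unfolding fps_conv_radius_def
    using sums by (intro conv_radius_inftyI'') (auto intro: sums_summable)
  have eval: "eval_fps F = struve_h \<nu>"
    unfolding eval_fps_def by (simp add: fun_eq_iff sums_unique[OF sums, symmetric])
  show "struve_h \<nu> holomorphic_on UNIV"
    unfolding eval[symmetric] by (rule holomorphic_on_eval_fps) (simp add: radius)
  have "struve_h \<nu> has_fps_expansion F"
    unfolding eval[symmetric] by (rule eval_fps_has_fps_expansion) (simp add: radius)
  from fps_nth_fps_expansion[OF this, of "Suc n"]
  show "(deriv ^^ Suc n) (struve_h \<nu>) 0 = fact (Suc n) * a n"
    by (simp add: F_def del: fact_Suc)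
qed

lemma deriv_struve_h_0:
  assumes "\<nu> > - 3 / 2"
  shows "deriv (struve_h \<nu>) 0 = 1"
proof -
  have "(1 / 2 :: real) \<notin> \<int>\<^sub>\<le>\<^sub>0" using nonpos_Ints_nonpos[of "1 / 2 :: real"] by auto
  then have "Gamma (1 / 2 + 1 :: real) = sqrt pi / 2"
    by (subst Gamma_plus1) (auto simp: Gamma_one_half_real)
  then have "Gamma (3 / 2 :: real) = sqrt pi / 2" by simp
  then have "Gamma (of_real (3 / 2) :: complex) = of_real (sqrt pi / 2)"
    by (simp only: Gamma_complex_of_real)
  then have Gamma_3_2: "Gamma (3 / 2 :: complex) = of_real (sqrt pi) / 2" by simp
  have "Gamma (of_real \<nu> + 3 / 2 :: complex) = of_real (Gamma (\<nu> + 3 / 2))"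
    by (simp flip: Gamma_complex_of_real)
  moreover have "Gamma (\<nu> + 3 / 2) > 0" using assms by (intro Gamma_real_pos) auto
  ultimately have "Gamma (of_real \<nu> + 3 / 2 :: complex) \<noteq> 0" by simp
  then have "deriv (struve_h \<nu>) 0 = of_real (sqrt pi) / 2 / Gamma (3 / 2)"
    using higher_deriv_struve_h_0[of 0 \<nu>] by simp
  then show ?thesis unfolding Gamma_3_2 by simp
qed

text \<open>
  The functional equation of the Gamma function, applied to both Gamma factors of the
  coefficients. Stated without division and proved with the entire function \<open>rGamma = 1 / Gamma\<close>,
  the recurrence holds for every real \<open>\<nu>\<close>, also where a Gamma factor has a pole.
\<close>

lemma higher_deriv_struve_h_0_Suc:
  "4 * (of_nat n + 3 / 2) * (of_real \<nu> + of_nat n + 3 / 2)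
      * (deriv ^^ Suc (Suc n)) (struve_h \<nu>) 0
    = - (of_nat n + 2) * (deriv ^^ Suc n) (struve_h \<nu>) 0"
proof -
  define x y where "x = (of_nat n + 3 / 2 :: complex)" and "y = of_real \<nu> + x"
  define C where "C = of_real (sqrt pi) / 2 * Gamma (of_real \<nu> + 3 / 2) * (- 1) ^ n / 4 ^ n
      * fact (Suc n) * rGamma (x + 1) * rGamma (y + 1)"
  have rG: "rGamma x = x * rGamma (x + 1)" "rGamma y = y * rGamma (y + 1)"
    by (simp_all add: rGamma_plus1)
  have "(deriv ^^ Suc n) (struve_h \<nu>) 0
      = of_real (sqrt pi) / 2 * Gamma (of_real \<nu> + 3 / 2) * (- 1) ^ n / 4 ^ n
      * fact (Suc n) * rGamma x * rGamma y"
    unfolding higher_deriv_struve_h_0 x_def y_def rGamma_inverse_Gamma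
    by (simp add: field_simps del: fact_Suc)
  also have "\<dots> = C * (x * y)" unfolding C_def rG by (simp del: fact_Suc)
  finally have d1: "(deriv ^^ Suc n) (struve_h \<nu>) 0 = C * (x * y)" .
  have xy1: "of_nat (Suc n) + 3 / 2 = x + 1" "of_real \<nu> + of_nat (Suc n) + 3 / 2 = y + 1"
    by (simp_all add: x_def y_def)
  have Suc_n: "of_nat (Suc (Suc n)) = (of_nat n + 2 :: complex)"
    "(- 1) ^ Suc n = (- ((- 1) ^ n) :: complex)" "4 ^ Suc n = (4 * 4 ^ n :: complex)"
    by simp_all
  have rearrange: "N * F * (S * (- p * G / (4 * q * a * b)))
      = - N / 4 * (S * G * p / q * F * inverse a * inverse b)"
    for N F S p G q a b :: complex
    by (simp add: field_simps)
  have d2: "(deriv ^^ Suc (Suc n)) (struve_h \<nu>) 0 = - (of_nat n + 2) / 4 * C"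
    unfolding higher_deriv_struve_h_0 xy1 C_def rGamma_inverse_Gamma fact_Suc[of "Suc n"]
      Suc_n
    by (rule rearrange)
  have "4 * (of_nat n + 3 / 2) * (of_real \<nu> + of_nat n + 3 / 2) = 4 * x * y"
    by (simp add: x_def y_def add_ac)
  then show ?thesis unfolding d1 d2 by simp
qed

lemma norm_higher_deriv_struve_h_0_Suc:
  assumes "\<nu> > - 3 / 2"
  shows "norm ((deriv ^^ Suc (Suc n)) (struve_h \<nu>) 0)
    = (real n + 2) / (4 * (real n + 3 / 2) * (\<nu> + real n + 3 / 2))
      * norm ((deriv ^^ Suc n) (struve_h \<nu>) 0)"
proof -
  have "norm (4 * (of_nat n + 3 / 2) * (of_real \<nu> + of_nat n + 3 / 2) :: complex)
      = norm (of_real (4 * (real n + 3 / 2) * (\<nu> + real n + 3 / 2)) :: complex)"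
    by simp
  also have "\<dots> = 4 * (real n + 3 / 2) * (\<nu> + real n + 3 / 2)"
    using assms by (subst norm_of_real) (simp add: abs_mult)
  finally have 1: "norm (4 * (of_nat n + 3 / 2) * (of_real \<nu> + of_nat n + 3 / 2) :: complex)
      = 4 * (real n + 3 / 2) * (\<nu> + real n + 3 / 2)" .
  have "norm (- (of_nat n + 2) :: complex) = norm (of_nat (n + 2) :: complex)"
    by (simp only: norm_minus_cancel) (simp add: add.commute)
  also have "\<dots> = real n + 2" by (subst norm_of_nat) simp
  finally have 2: "norm (- (of_nat n + 2) :: complex) = real n + 2" .
  have "4 * (real n + 3 / 2) * (\<nu> + real n + 3 / 2) > 0"
    using assms by simp
  moreover have "4 * (real n + 3 / 2) * (\<nu> + real n + 3 / 2)
      * norm ((deriv ^^ Suc (Suc n)) (struve_h \<nu>) 0)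
      = (real n + 2) * norm ((deriv ^^ Suc n) (struve_h \<nu>) 0)"
    using arg_cong[OF higher_deriv_struve_h_0_Suc[of n \<nu>], of norm]
    by (simp only: norm_mult[of _ "(deriv ^^ _) _ _"] 1 2)
  ultimately show ?thesis
    by (metis eq_divide_imp less_irrefl mult.commute times_divide_eq_left)
qed

section \<open>Starlikeness and close-to-convexity\<close>

theorem theorem2:
  fixes \<nu> :: real
  assumes "\<bar>\<nu>\<bar> \<le> 1 / 2"
  shows "starlike_fun (struve_h \<nu>) \<and> (\<forall>k\<ge>1. close_to_convex ((deriv ^^ k) (struve_h \<nu>)))"
proof -
  let ?h = "struve_h \<nu>"
  have \<nu>: "\<nu> > - 3 / 2" "\<nu> \<ge> - 1 / 2" using assms by auto
  note norm_Suc = norm_higher_deriv_struve_h_0_Suc[OF \<nu>(1)]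
  have hol: "?h holomorphic_on ball 0 1"
    using holomorphic_struve_h by (rule holomorphic_on_subset) simp
  have nonzero: "(deriv ^^ Suc n) ?h 0 \<noteq> 0" for n
  proof (induction n)
    case 0
    then show ?case using deriv_struve_h_0[OF \<nu>(1)] by simp
  next
    case (Suc n)
    have "(real n + 2) / (4 * (real n + 3 / 2) * (\<nu> + real n + 3 / 2)) > 0"
      using \<nu> by simp
    with Suc have "norm ((deriv ^^ Suc (Suc n)) ?h 0) > 0"
      unfolding norm_Suc by (intro mult_pos_pos) auto
    then show ?case by (simp only: zero_less_norm_iff not_False_eq_True)
  qed
  \<comment> \<open>The factor in the recurrence is largest for \<open>m = 1\<close> and \<open>\<nu> = - 1 / 2\<close>, where it is
    \<open>3 / (4 (5/2) 2) = 3 / 20\<close>.\<close>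
  have ratio: "norm ((deriv ^^ Suc n) ?h 0) \<le> 3 / 20 * norm ((deriv ^^ n) ?h 0)" if "n \<ge> 2" for n
  proof -
    obtain m where m: "n = Suc m" "m \<ge> 1" using \<open>n \<ge> 2\<close> by (cases n) auto
    have "(real m + 3 / 2) * (\<nu> + real m + 3 / 2) \<ge> (real m + 3 / 2) * 2"
      using m \<nu> by (intro mult_left_mono) auto
    then have "(real m + 2) / (4 * (real m + 3 / 2) * (\<nu> + real m + 3 / 2)) \<le> 3 / 20"
      using m \<nu> by (subst pos_divide_le_eq) (auto simp: algebra_simps)
    then show ?thesis unfolding m norm_Suc by (rule mult_right_mono) simp
  qed
  have near: "norm ((deriv ^^ k) ?h z - (deriv ^^ k) ?h 0) \<le> 3 / 17 * norm ((deriv ^^ k) ?h 0)"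
    if "k \<ge> 2" "z \<in> ball 0 1" for k z
    using higher_deriv_near_value_at_0[OF hol, of k "3 / 20" z] ratio that by simp
  have "starlike_fun ?h"
  proof (rule starlike_fun_if_second_deriv_le_half[OF hol])
    show "?h 0 = 0" by (simp add: struve_h_def)
    show "deriv ?h 0 = 1" using \<nu>(1) by (rule deriv_struve_h_0)
    fix z :: complex assume z: "z \<in> ball 0 1"
    have two: "(deriv ^^ 2) ?h = deriv (deriv ?h)" by (simp add: numeral_2_eq_2)
    have "norm (deriv (deriv ?h) 0) = 2 / (6 * (\<nu> + 3 / 2))"
      using norm_Suc[of 0] deriv_struve_h_0[OF \<nu>(1)] by simp
    also have "\<dots> \<le> 1 / 3" using \<nu> by (simp add: divide_simps)
    finally have "norm (deriv (deriv ?h) 0) \<le> 1 / 3" .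
    moreover have "norm (deriv (deriv ?h) z - deriv (deriv ?h) 0)
        \<le> 3 / 17 * norm (deriv (deriv ?h) 0)"
      using near[of 2 z] z by (simp add: two)
    moreover have "norm (deriv (deriv ?h) z)
        \<le> norm (deriv (deriv ?h) 0) + norm (deriv (deriv ?h) z - deriv (deriv ?h) 0)"
      by (rule norm_triangle_sub)
    ultimately show "norm (deriv (deriv ?h) z) \<le> 1 / 2" by linarith
  qed
  moreover have "close_to_convex ((deriv ^^ k) ?h)" if "k \<ge> 1" for k
  proof (rule close_to_convex_if_deriv_near_const)
    show "(deriv ^^ k) ?h holomorphic_on ball 0 1"
      using hol by (intro holomorphic_higher_deriv) auto
    fix z :: complex assume z: "z \<in> ball 0 1"
    have "norm ((deriv ^^ Suc k) ?h z - (deriv ^^ Suc k) ?h 0)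
        \<le> 3 / 17 * norm ((deriv ^^ Suc k) ?h 0)"
      using near[of "Suc k" z] z that by linarith
    also have "\<dots> < norm ((deriv ^^ Suc k) ?h 0)"
      using nonzero[of k] by simp
    finally show "norm (deriv ((deriv ^^ k) ?h) z - (deriv ^^ Suc k) ?h 0)
        < norm ((deriv ^^ Suc k) ?h 0)" by simp
  qed
  ultimately show ?thesis by blast
qed

end
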